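(* Let $f,Z,z_0,\Xi=\{\xi\in\mathbb{R}^n: C\xi\le d\},\mathcal{R}=[\mathcal{R}_{\min},\mathcal{R}_{\max}],\widehat\xi_i,N,\epsilon,\mathcal{Q}$, the positive integer $\mathcal{K}$ and the points $\underline\eta_k,\bar\eta_k$ be as in the context (in particular $\Xi$ is polyhedral and $z_0^T\Xi$ is compact). Assume that for all $i=1,\dots,N$, $k=1,\dots,\mathcal{K}$ (and all $z\in Z$) the problems $(P^{ik}_{SSD-1})$ and $(P^{ik}_{SSD-2})$ of the context are strictly feasible. Then the optimal value of the following problem $(P_{SSD-U})$ is an upper bound for the optimal value of problem $(P_{SSD})$: minimize $f(z)$ over $z\in Z$, $\lambda\in\mathbb{R}^{\mathcal{K}}_+$ and, for $i=1,\dots,N$, $k=1,\dots,\mathcal{K}$, $\mu^{ik},\tilde\mu^{ik}\in\mathbb{R}^3_+$, $\nu^{ik},\tilde\nu^{ik}\in\mathbb{R}^l_+$, $V^{ik}\in\mathbb{R}$, subject to $$\lambda_k\epsilon+\frac1N\sum_{i=1}^NV^{ik}\le0,\qquad k=1,\dots,\mathcal{K},$$ and, for all $i=1,\dots,N$, $k=1,\dots,\mathcal{K}$, $$\mu_1^{ik}\le1,\quad\tilde\mu_1^{ik}\le1,\quad1-\mu_1^{ik}+\mu_2^{ik}+\mu_3^{ik}\ge0,\quad-\tilde\mu_1^{ik}-\tilde\mu_2^{ik}+\tilde\mu_3^{ik}\ge0,$$ $$V^{ik}\ge d^T\nu^{ik}-\widehat\xi_i^T(z-\mu_1^{ik}z_0+\mu_2^{ik}z+C^T\nu^{ik})-\mu_3^{ik}\underline\eta_k+(1-\mu_1^{ik}+\mu_2^{ik}+\mu_3^{ik})\bar\eta_k,$$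 $$V^{ik}\ge d^T\tilde\nu^{ik}-\widehat\xi_i^T(-\tilde\mu_1^{ik}z_0-\tilde\mu_2^{ik}z+C^T\tilde\nu^{ik})-\tilde\mu_3^{ik}\underline\eta_k+(-\tilde\mu_1^{ik}-\tilde\mu_2^{ik}+\tilde\mu_3^{ik})\bar\eta_k,$$ $$\|z-\mu_1^{ik}z_0+\mu_2^{ik}z+C^T\nu^{ik}\|\le\lambda_k,\qquad\|-\tilde\mu_1^{ik}z_0-\tilde\mu_2^{ik}z+C^T\tilde\nu^{ik}\|\le\lambda_k.$$
   Context: Notation: $(a)_+=\max\{a,0\}$; $\|\cdot\|$ is the Euclidean norm. The optimal value of an infeasible minimization problem is $+\infty$. Setting: $f:\mathbb{R}^n\to\mathbb{R}$ is continuous; $Z\subset\mathbb{R}^n$ is a bounded polyhedral set; $z_0\in Z$. The support set is $\Xi=\{\xi\in\mathbb{R}^n: C\xi\le d\}$ with $C\in\mathbb{R}^{l\times n}$, $d\in\mathbb{R}^l$, and $\mathcal{R}:=\{z_0^T\xi:\xi\in\Xi\}$ is compact, $\mathcal{R}=[\mathcal{R}_{\min},\mathcal{R}_{\max}]$. $\mathscr{P}(\Xi)$ is the set of Borel probability measures on $\Xi$ with $\mathbb{E}_P[\|\xi\|]<\infty$, $d_K$ is the 1-Wasserstein (Kantorovich) metric, $\widehat P_N=\frac1N\sum_{i=1}^N\delta_{\widehat\xi_i}$ with observations $\widehat\xi_i\in\Xi$, and $\mathcal{Q}=\{P\in\mathscr{P}(\Xi): d_K(P,\widehat P_N)\le\epsilon\}$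 with radius $\epsilon>0$. Problem $(P_{SSD})$: minimize $f(z)$ over $z\in Z$ subject to $z^T\xi$ dominating $z_0^T\xi$ robustly in the second order over $\mathcal{Q}$, i.e. $\mathbb{E}_P[u(z^T\xi)]\ge\mathbb{E}_P[u(z_0^T\xi)]$ for all non-decreasing concave $u:\mathbb{R}\to\mathbb{R}$ and all $P\in\mathcal{Q}$; equivalently $\mathbb{E}_P[(\eta-z^T\xi)_+-(\eta-z_0^T\xi)_+]\le0$ for all $\eta\in\mathbb{R}$ and all $P\in\mathcal{Q}$ (equivalently, for all $\eta\in\mathcal{R}$ and all $P\in\mathcal{Q}$). For a positive integer $\mathcal{K}$ and $k=1,\dots,\mathcal{K}$: $\underline\eta_k=\mathcal{R}_{\min}+(k-1)\frac{\mathcal{R}_{\max}-\mathcal{R}_{\min}}{\mathcal{K}}$, $\bar\eta_k=\mathcal{R}_{\min}+k\frac{\mathcal{R}_{\max}-\mathcal{R}_{\min}}{\mathcal{K}}$. Given $z$ and $\lambda_k\ge0$, with variables $\xi\in\mathbb{R}^n$, $\eta,s,m\in\mathbb{R}$: $(P^{ik}_{SSD-1})$: maximize $\eta-z^T\xi-s-\lambda_km$ subject to $s\ge\eta-z_0^T\xi$, $\eta-z^T\xi\ge0$, $C\xi\le d$, $s\ge0$, $\eta\ge\underline\eta_k$, $\eta\le\bar\eta_k$, $\|\xi-\widehat\xi_i\|\le m$. $(P^{ik}_{SSD-2})$: maximize $-s-\lambda_km$ subject to $s\ge\eta-z_0^T\xi$, $\eta-z^T\xi\le0$, $C\xi\le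 d$, $s\ge0$, $\eta\ge\underline\eta_k$, $\eta\le\bar\eta_k$, $\|\xi-\widehat\xi_i\|\le m$. Such a problem is strictly feasible if some point satisfies all its inequality constraints strictly. *)

theory Defs
  imports "HOL-Probability.Probability"
begin

text \<open>An infeasible minimization problem has value \<open>\<infinity>\<close>, since \<open>Inf {} = \<infinity>\<close> in \<open>ereal\<close>.\<close>

definition optimal_value :: "('a \<Rightarrow> real) \<Rightarrow> 'a set \<Rightarrow> ereal" where
  "optimal_value f S = (INF x\<in>S. ereal (f x))"

definition support_set :: "real^'n^'l \<Rightarrow> real^'l \<Rightarrow> (real^'n) set" where
  "support_set C d = {\<xi>. \<forall>j. (C *v \<xi>) $ j \<le> d $ j}"

definition prob_measures :: "(real^'n) set \<Rightarrow> (real^'n) measure set" where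
  "prob_measures \<Xi> =
    {P. prob_space P \<and> sets P = sets (restrict_space borel \<Xi>) \<and> integrable P norm}"

definition couplings :: "'a measure \<Rightarrow> 'b measure \<Rightarrow> ('a \<times> 'b) measure set" where
  "couplings P Q =
    {\<pi>. prob_space \<pi> \<and> sets \<pi> = sets (P \<Otimes>\<^sub>M Q) \<and> distr \<pi> P fst = P \<and> distr \<pi> Q snd = Q}"

definition kantorovich :: "'a::metric_space measure \<Rightarrow> 'a measure \<Rightarrow> ennreal" where
  "kantorovich P Q = (INF \<pi>\<in>couplings P Q. \<integral>\<^sup>+(x, y). ennreal (dist x y) \<partial>\<pi>)"

text \<open>The image of the uniform distribution on \<open>{1..N}\<close> under \<open>i \<mapsto> \<xi>h i\<close>, that is, the average
  of the Dirac measures at \<open>\<xi>h 1, \<dots>, \<xi>h N\<close>, counted with multiplicity.\<close>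

definition empirical_measure ::
    "(real^'n) set \<Rightarrow> nat \<Rightarrow> (nat \<Rightarrow> real^'n) \<Rightarrow> (real^'n) measure" where
  "empirical_measure \<Xi> N \<xi>h =
    distr (uniform_count_measure {1..N}) (restrict_space borel \<Xi>) \<xi>h"

definition ambiguity_set ::
    "(real^'n) set \<Rightarrow> nat \<Rightarrow> (nat \<Rightarrow> real^'n) \<Rightarrow> real \<Rightarrow> (real^'n) measure set" where
  "ambiguity_set \<Xi> N \<xi>h \<epsilon> =
    {P \<in> prob_measures \<Xi>. kantorovich P (empirical_measure \<Xi> N \<xi>h) \<le> ennreal \<epsilon>}"

text \<open>Extended-valued expectation. The Bochner integral would silently be \<open>0\<close> where a utility has
  expectation \<open>- \<infinity>\<close>, which can happen because \<open>z \<bullet> \<xi>\<close> may be unbounded below on the support.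
  The indeterminate case \<open>\<infinity> - \<infinity>\<close> does not arise below: a concave function of an integrable random
  variable has an integrable positive part.\<close>

definition expectation_ereal :: "'a measure \<Rightarrow> ('a \<Rightarrow> real) \<Rightarrow> ereal" where
  "expectation_ereal M X =
    enn2ereal (\<integral>\<^sup>+x. ennreal (X x) \<partial>M) - enn2ereal (\<integral>\<^sup>+x. ennreal (- X x) \<partial>M)"

definition ssd_dominates :: "'a measure \<Rightarrow> ('a \<Rightarrow> real) \<Rightarrow> ('a \<Rightarrow> real) \<Rightarrow> bool" where
  "ssd_dominates M X Y \<longleftrightarrow>
    (\<forall>u :: real \<Rightarrow> real. mono u \<and> concave_on UNIV u \<longrightarrow>
      expectation_ereal M (\<lambda>\<omega>. u (X \<omega>)) \<ge> expectation_ereal M (\<lambda>\<omega>. u (Y \<omega>)))"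

definition ssd_feasible ::
    "(real^'n) set \<Rightarrow> real^'n \<Rightarrow> (real^'n) measure set \<Rightarrow> (real^'n) set" where
  "ssd_feasible Z z0 \<Q> =
    {z \<in> Z. \<forall>P\<in>\<Q>. ssd_dominates P (\<lambda>\<xi>. z \<bullet> \<xi>) (\<lambda>\<xi>. z0 \<bullet> \<xi>)}"

definition eta_lower :: "real \<Rightarrow> real \<Rightarrow> nat \<Rightarrow> nat \<Rightarrow> real" where
  "eta_lower Rmin Rmax K k = Rmin + (real k - 1) * ((Rmax - Rmin) / real K)"

definition eta_upper :: "real \<Rightarrow> real \<Rightarrow> nat \<Rightarrow> nat \<Rightarrow> real" where
  "eta_upper Rmin Rmax K k = Rmin + real k * ((Rmax - Rmin) / real K)"

text \<open>Strict feasibility of the two subproblems, with arguments \<open>C d z0 z \<xi>i lo up\<close>, where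
  \<open>\<xi>i\<close> is the observation and \<open>[lo, up]\<close> the range of \<open>\<eta>\<close>. It involves only the constraints, so
  neither the objectives nor \<open>\<lambda>\<^sub>k\<close> occur. The strict constraints on \<open>C *v \<xi>\<close> are componentwise;
  \<open><\<close> on vectors means something weaker.\<close>

definition ssd1_strictly_feasible ::
    "real^'n^'l \<Rightarrow> real^'l \<Rightarrow> real^'n \<Rightarrow> real^'n \<Rightarrow> real^'n \<Rightarrow> real \<Rightarrow> real \<Rightarrow> bool" where
  "ssd1_strictly_feasible C d z0 z \<xi>i lo up \<longleftrightarrow>
    (\<exists>\<xi> \<eta> s m. s > \<eta> - z0 \<bullet> \<xi> \<and> \<eta> - z \<bullet> \<xi> > 0 \<and> (\<forall>j. (C *v \<xi>) $ j < d $ j) \<and> s > 0 \<and>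
      \<eta> > lo \<and> \<eta> < up \<and> norm (\<xi> - \<xi>i) < m)"

definition ssd2_strictly_feasible ::
    "real^'n^'l \<Rightarrow> real^'l \<Rightarrow> real^'n \<Rightarrow> real^'n \<Rightarrow> real^'n \<Rightarrow> real \<Rightarrow> real \<Rightarrow> bool" where
  "ssd2_strictly_feasible C d z0 z \<xi>i lo up \<longleftrightarrow>
    (\<exists>\<xi> \<eta> s m. s > \<eta> - z0 \<bullet> \<xi> \<and> \<eta> - z \<bullet> \<xi> < 0 \<and> (\<forall>j. (C *v \<xi>) $ j < d $ j) \<and> s > 0 \<and>
      \<eta> > lo \<and> \<eta> < up \<and> norm (\<xi> - \<xi>i) < m)"

text \<open>The constraints of the upper-bound problem for one pair \<open>(i, k)\<close>; \<open>\<xi>i, lo, up\<close> are as above and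
  \<open>lam, \<mu>, \<mu>', \<nu>, \<nu>', V\<close> are the values of the decision variables for that pair.\<close>

definition ssdU_constraints ::
    "real^'n^'l \<Rightarrow> real^'l \<Rightarrow> real^'n \<Rightarrow> real^'n \<Rightarrow> real^'n \<Rightarrow> real \<Rightarrow> real \<Rightarrow>
     real \<Rightarrow> real^3 \<Rightarrow> real^3 \<Rightarrow> real^'l \<Rightarrow> real^'l \<Rightarrow> real \<Rightarrow> bool" where
  "ssdU_constraints C d z0 z \<xi>i lo up lam \<mu> \<mu>' \<nu> \<nu>' V \<longleftrightarrow>
    (\<forall>j. 0 \<le> \<mu> $ j) \<and> (\<forall>j. 0 \<le> \<mu>' $ j) \<and> (\<forall>j. 0 \<le> \<nu> $ j) \<and> (\<forall>j. 0 \<le> \<nu>' $ j) \<and>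
    \<mu> $ 1 \<le> 1 \<and> \<mu>' $ 1 \<le> 1 \<and>
    1 - \<mu> $ 1 + \<mu> $ 2 + \<mu> $ 3 \<ge> 0 \<and>
    - \<mu>' $ 1 - \<mu>' $ 2 + \<mu>' $ 3 \<ge> 0 \<and>
    V \<ge> d \<bullet> \<nu> - \<xi>i \<bullet> (z - \<mu> $ 1 *\<^sub>R z0 + \<mu> $ 2 *\<^sub>R z + transpose C *v \<nu>)
        - \<mu> $ 3 * lo + (1 - \<mu> $ 1 + \<mu> $ 2 + \<mu> $ 3) * up \<and>
    V \<ge> d \<bullet> \<nu>' - \<xi>i \<bullet> (- (\<mu>' $ 1 *\<^sub>R z0) - \<mu>' $ 2 *\<^sub>R z + transpose C *v \<nu>')
        - \<mu>' $ 3 * lo + (- \<mu>' $ 1 - \<mu>' $ 2 + \<mu>' $ 3) * up \<and>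
    norm (z - \<mu> $ 1 *\<^sub>R z0 + \<mu> $ 2 *\<^sub>R z + transpose C *v \<nu>) \<le> lam \<and>
    norm (- (\<mu>' $ 1 *\<^sub>R z0) - \<mu>' $ 2 *\<^sub>R z + transpose C *v \<nu>') \<le> lam"

text \<open>Families indexed by \<open>k \<in> {1..K}\<close> or \<open>(i, k) \<in> {1..N} \<times> {1..K}\<close> are functions on \<open>nat\<close>; their
  values at other indices are unconstrained and do not affect the objective.\<close>

definition ssdU_feasible ::
    "(real^'n) set \<Rightarrow> real^'n \<Rightarrow> real^'n^'l \<Rightarrow> real^'l \<Rightarrow> real \<Rightarrow> real \<Rightarrow> nat \<Rightarrow> (nat \<Rightarrow> real^'n) \<Rightarrow>
     real \<Rightarrow> nat \<Rightarrow>
     ((real^'n) \<times> (nat \<Rightarrow> real) \<times> (nat \<Rightarrow> nat \<Rightarrow> real^3) \<times> (nat \<Rightarrow> nat \<Rightarrow> real^3) \<times>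
      (nat \<Rightarrow> nat \<Rightarrow> real^'l) \<times> (nat \<Rightarrow> nat \<Rightarrow> real^'l) \<times> (nat \<Rightarrow> nat \<Rightarrow> real)) set" where
  "ssdU_feasible Z z0 C d Rmin Rmax N \<xi>h \<epsilon> K =
    {(z, lam, \<mu>, \<mu>', \<nu>, \<nu>', V).
      z \<in> Z \<and>
      (\<forall>k\<in>{1..K}. 0 \<le> lam k \<and> lam k * \<epsilon> + (1 / real N) * (\<Sum>i=1..N. V i k) \<le> 0) \<and>
      (\<forall>i\<in>{1..N}. \<forall>k\<in>{1..K}.
        ssdU_constraints C d z0 z (\<xi>h i) (eta_lower Rmin Rmax K k) (eta_upper Rmin Rmax K k)
          (lam k) (\<mu> i k) (\<mu>' i k) (\<nu> i k) (\<nu>' i k) (V i k))}"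

end

theory Submission
  imports Defs
begin

text \<open>Only weak duality is needed. A feasible point of the upper-bound problem carries, for each pair
  \<open>(i, k)\<close>, Lagrange multipliers which certify that
  \<open>max 0 (\<eta> - z \<bullet> \<xi>) - max 0 (\<eta> - z0 \<bullet> \<xi>) \<le> V i k + lam k * dist \<xi> (\<xi>h i)\<close> on the support for all
  \<open>\<eta>\<close> in the \<open>k\<close>-th subinterval. Integrating along almost optimal couplings of \<open>P\<close> with the empirical
  measure gives \<open>E\<^sub>P[max 0 (\<eta> - z \<bullet> \<xi>)] \<le> E\<^sub>P[max 0 (\<eta> - z0 \<bullet> \<xi>)]\<close>. Monotone concave utilities are
  reduced to such ramps by piecewise linear interpolation, so \<open>z\<close> is feasible for the robust SSD
  problem.\<close>

section \<open>Lagrangian bounds on the support\<close>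

text \<open>Weak duality for the two subproblems: if \<open>z \<bullet> \<xi> \<le> \<eta>\<close>
  the point meets the constraints of the first, otherwise those of the second, with
  \<open>s = max 0 (\<eta> - z0 \<bullet> \<xi>)\<close>. Nonnegative multiples of the slacks are
  added to the objective; the resulting coefficient of \<open>\<eta>\<close> is nonnegative and acts
  as the multiplier of \<open>\<eta> \<le> up\<close>.\<close>

lemma ssdU_pointwise_bound:
  fixes z0 z \<xi> \<xi>i :: "real^'n" and C :: "real^'n^'l"
  assumes U: "ssdU_constraints C d z0 z \<xi>i lo up lam \<mu> \<mu>' \<nu> \<nu>' V"
    and \<xi>: "\<xi> \<in> support_set C d" and \<eta>: "lo \<le> \<eta>" "\<eta> \<le> up"
  shows "max 0 (\<eta> - z \<bullet> \<xi>) - max 0 (\<eta> - z0 \<bullet> \<xi>) \<le> V + lam * dist \<xi> \<xi>i"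
proof -
  have slack: "(C *v \<xi>) \<bullet> n \<le> d \<bullet> n" if "\<forall>j. 0 \<le> n $ j" for n :: "real^'l"
    using \<xi> that by (auto simp: support_set_def inner_vec_def intro!: sum_mono mult_right_mono)
  have adj: "\<xi> \<bullet> (transpose C *v n) = (C *v \<xi>) \<bullet> n" for n :: "real^'l"
    by (metis dot_lmul_matrix inner_commute vector_transpose_matrix transpose_transpose)
  have cs: "- ((\<xi> - \<xi>i) \<bullet> w) \<le> lam * dist \<xi> \<xi>i" if "norm w \<le> lam" for w
  proof -
    have "- ((\<xi> - \<xi>i) \<bullet> w) \<le> norm (\<xi> - \<xi>i) * norm w"
      using Cauchy_Schwarz_ineq2[of "\<xi> - \<xi>i" w] by linarith
    also have "\<dots> \<le> norm (\<xi> - \<xi>i) * lam"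
      using that by (intro mult_left_mono) auto
    finally show ?thesis by (simp add: dist_norm mult.commute)
  qed
  show ?thesis
  proof (cases "z \<bullet> \<xi> \<le> \<eta>")
    case True
    \<comment> \<open>The coefficient of \<open>- \<xi>\<close> in the Lagrangian. Splitting
      \<open>\<xi>\<close> as \<open>\<xi>i + (\<xi> - \<xi>i)\<close> leaves a remainder that
      Cauchy-Schwarz bounds by \<open>lam * dist \<xi> \<xi>i\<close>.\<close>
    define w where "w = z - \<mu> $ 1 *\<^sub>R z0 + \<mu> $ 2 *\<^sub>R z + transpose C *v \<nu>"
    \<comment> \<open>The multiplier of \<open>s \<ge> 0\<close> is \<open>1 - \<mu> $ 1\<close>,
      which is where \<open>\<mu> $ 1 \<le> 1\<close> enters.\<close>
    have "\<mu> $ 1 * (\<eta> - z0 \<bullet> \<xi>) \<le> max 0 (\<eta> - z0 \<bullet> \<xi>)"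
      using U mult_left_mono[of "\<eta> - z0 \<bullet> \<xi>" "max 0 (\<eta> - z0 \<bullet> \<xi>)" "\<mu> $ 1"]
        mult_right_mono[of "\<mu> $ 1" 1 "max 0 (\<eta> - z0 \<bullet> \<xi>)"]
      by (auto simp: ssdU_constraints_def)
    moreover have "0 \<le> \<mu> $ 2 * (\<eta> - z \<bullet> \<xi>)" "0 \<le> \<mu> $ 3 * (\<eta> - lo)"
      using U True \<eta> by (auto simp: ssdU_constraints_def)
    moreover have "(1 - \<mu> $ 1 + \<mu> $ 2 + \<mu> $ 3) * \<eta> \<le> (1 - \<mu> $ 1 + \<mu> $ 2 + \<mu> $ 3) * up"
      using U \<eta> by (intro mult_left_mono) (auto simp: ssdU_constraints_def)
    moreover have "(C *v \<xi>) \<bullet> \<nu> \<le> d \<bullet> \<nu>"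
      using U by (intro slack) (auto simp: ssdU_constraints_def)
    moreover have "- (\<xi> \<bullet> w) + \<xi>i \<bullet> w \<le> lam * dist \<xi> \<xi>i"
      using cs[of w] U by (auto simp: ssdU_constraints_def w_def inner_diff_left)
    moreover have "\<xi> \<bullet> w = z \<bullet> \<xi> - \<mu> $ 1 * (z0 \<bullet> \<xi>) + \<mu> $ 2 * (z \<bullet> \<xi>) + (C *v \<xi>) \<bullet> \<nu>"
      unfolding w_def inner_add_right inner_diff_right adj by (simp add: inner_commute)
    moreover have "V \<ge> d \<bullet> \<nu> - \<xi>i \<bullet> w - \<mu> $ 3 * lo + (1 - \<mu> $ 1 + \<mu> $ 2 + \<mu> $ 3) * up"
      using U by (auto simp: ssdU_constraints_def w_def)
    moreover have "max 0 (\<eta> - z \<bullet> \<xi>) = \<eta> - z \<bullet> \<xi>" using True by simp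
    ultimately show ?thesis by (simp add: algebra_simps)
  next
    case False
    \<comment> \<open>The term \<open>\<eta> - z \<bullet> \<xi>\<close> is now absent from the
      objective and its constraint is reversed, hence the opposite sign of
      \<open>\<mu>' $ 2\<close>.\<close>
    define w where "w = - (\<mu>' $ 1 *\<^sub>R z0) - \<mu>' $ 2 *\<^sub>R z + transpose C *v \<nu>'"
    have "\<mu>' $ 1 * (\<eta> - z0 \<bullet> \<xi>) \<le> max 0 (\<eta> - z0 \<bullet> \<xi>)"
      using U mult_left_mono[of "\<eta> - z0 \<bullet> \<xi>" "max 0 (\<eta> - z0 \<bullet> \<xi>)" "\<mu>' $ 1"]
        mult_right_mono[of "\<mu>' $ 1" 1 "max 0 (\<eta> - z0 \<bullet> \<xi>)"]
      by (auto simp: ssdU_constraints_def)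
    moreover have "0 \<le> \<mu>' $ 2 * (z \<bullet> \<xi> - \<eta>)" "0 \<le> \<mu>' $ 3 * (\<eta> - lo)"
      using U False \<eta> by (auto simp: ssdU_constraints_def)
    moreover have "(- \<mu>' $ 1 - \<mu>' $ 2 + \<mu>' $ 3) * \<eta> \<le> (- \<mu>' $ 1 - \<mu>' $ 2 + \<mu>' $ 3) * up"
      using U \<eta> by (intro mult_left_mono) (auto simp: ssdU_constraints_def)
    moreover have "(C *v \<xi>) \<bullet> \<nu>' \<le> d \<bullet> \<nu>'"
      using U by (intro slack) (auto simp: ssdU_constraints_def)
    moreover have "- (\<xi> \<bullet> w) + \<xi>i \<bullet> w \<le> lam * dist \<xi> \<xi>i"
      using cs[of w] U by (auto simp: ssdU_constraints_def w_def inner_diff_left)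
    moreover have "\<xi> \<bullet> w = - (\<mu>' $ 1 * (z0 \<bullet> \<xi>)) - \<mu>' $ 2 * (z \<bullet> \<xi>) + (C *v \<xi>) \<bullet> \<nu>'"
      unfolding w_def inner_add_right inner_diff_right adj by (simp add: inner_commute)
    moreover have "V \<ge> d \<bullet> \<nu>' - \<xi>i \<bullet> w - \<mu>' $ 3 * lo + (- \<mu>' $ 1 - \<mu>' $ 2 + \<mu>' $ 3) * up"
      using U by (auto simp: ssdU_constraints_def w_def)
    moreover have "max 0 (\<eta> - z \<bullet> \<xi>) = 0" using False by simp
    ultimately show ?thesis by (simp add: algebra_simps)
  qed
qed

text \<open>Consecutive cells share an endpoint, so a point beyond the first \<open>m\<close> cells
  lies above the lower end of the next. The induction runs over \<open>m\<close>, while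
  \<open>K\<close> stays fixed in the cell width.\<close>

lemma eta_cover:
  assumes "Rmin \<le> \<eta>" "\<eta> \<le> Rmax" "K > 0"
  obtains k where "k \<in> {1..K}" "eta_lower Rmin Rmax K k \<le> \<eta>" "\<eta> \<le> eta_upper Rmin Rmax K k"
proof -
  have "\<exists>k\<in>{1..m}. eta_lower Rmin Rmax K k \<le> \<eta> \<and> \<eta> \<le> eta_upper Rmin Rmax K k"
    if "m \<ge> 1" "\<eta> \<le> eta_upper Rmin Rmax K m" for m
    using that
  proof (induction m rule: nat_induct_at_least)
    case base
    then show ?case using assms by (auto simp: eta_lower_def)
  next
    case (Suc m)
    show ?case
    proof (cases "\<eta> \<le> eta_upper Rmin Rmax K m")
      case True
      then obtain k where "k \<in> {1..m}" "eta_lower Rmin Rmax K k \<le> \<eta>" "\<eta> \<le> eta_upper Rmin Rmax K k"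
        using Suc.IH by auto
      then show ?thesis by (intro bexI[of _ k]) auto
    next
      case False
      then have "eta_lower Rmin Rmax K (Suc m) \<le> \<eta>"
        by (simp add: eta_lower_def eta_upper_def)
      then show ?thesis using Suc.prems by (intro bexI[of _ "Suc m"]) auto
    qed
  qed
  from this[of K] show ?thesis
    using assms that by (auto simp: eta_upper_def)
qed

section \<open>Integrals and transport couplings\<close>

lemma expectation_ereal_eq_integral:
  assumes "integrable M g"
  shows "expectation_ereal M g = ereal (integral\<^sup>L M g)"
proof -
  have "(\<integral>\<^sup>+x. ennreal (g x) \<partial>M) \<noteq> \<infinity>" "(\<integral>\<^sup>+x. ennreal (- g x) \<partial>M) \<noteq> \<infinity>"
    using assms by (auto simp: real_integrable_def)
  then show ?thesis
    using real_lebesgue_integral_def[OF assms]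
    by (cases "\<integral>\<^sup>+x. ennreal (g x) \<partial>M"; cases "\<integral>\<^sup>+x. ennreal (- g x) \<partial>M")
       (auto simp: expectation_ereal_def enn2ereal_ennreal)
qed

text \<open>The easy half of Kantorovich duality: both integrals are lifted to the coupling through
  its marginals, where the pointwise inequality can be integrated.\<close>

lemma integral_le_coupling:
  fixes P Q :: "'a::{metric_space, second_countable_topology} measure"
  assumes \<pi>: "\<pi> \<in> couplings P Q"
    and [measurable]: "(\<lambda>x. x) \<in> measurable P borel" "(\<lambda>x. x) \<in> measurable Q borel"
    and h: "integrable P h" and g: "integrable Q g"
    and le: "\<And>x y. x \<in> space P \<Longrightarrow> y \<in> space Q \<Longrightarrow> h x \<le> g y + lam * dist x y"
    and lam: "0 \<le> lam"
    and cost: "(\<integral>\<^sup>+(x, y). ennreal (dist x y) \<partial>\<pi>) \<le> ennreal c" and c: "0 \<le> c"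
  shows "integral\<^sup>L P h \<le> integral\<^sup>L Q g + lam * c"
proof -
  from \<pi> have sets[measurable_cong]: "sets \<pi> = sets (P \<Otimes>\<^sub>M Q)"
    and d1: "distr \<pi> P fst = P" and d2: "distr \<pi> Q snd = Q"
    by (auto simp: couplings_def)
  have sp: "space \<pi> = space P \<times> space Q"
    using sets_eq_imp_space_eq[OF sets] by (simp add: space_pair_measure)
  have f[measurable]: "fst \<in> measurable \<pi> P" and s[measurable]: "snd \<in> measurable \<pi> Q"
    by measurable
  have dm: "(\<lambda>p. dist (fst p) (snd p)) \<in> borel_measurable \<pi>"
    using measurable_compose[OF f assms(2)] measurable_compose[OF s assms(3)]
    by (rule borel_measurable_dist)
  have cost': "(\<integral>\<^sup>+p. ennreal (dist (fst p) (snd p)) \<partial>\<pi>) \<le> ennreal c"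
    using cost by (simp add: split_beta')
  \<comment> \<open>Finite transport cost is what makes the distance integrable.\<close>
  have di: "integrable \<pi> (\<lambda>p. dist (fst p) (snd p))"
    using dm cost' by (intro integrableI_nonneg) (auto simp: top_unique less_top[symmetric] ennreal_less_top intro: le_less_trans)
  have hi: "integrable \<pi> (\<lambda>p. h (fst p))"
    using h d1 integrable_distr[OF f, of h] by simp
  have gi: "integrable \<pi> (\<lambda>p. g (snd p))"
    using g d2 integrable_distr[OF s, of g] by simp
  have "ennreal (\<integral>p. dist (fst p) (snd p) \<partial>\<pi>) \<le> ennreal c"
    using cost' nn_integral_eq_integral[OF di] by simp
  then have dc: "(\<integral>p. dist (fst p) (snd p) \<partial>\<pi>) \<le> c" using c by simp
  have "integral\<^sup>L P h = (\<integral>p. h (fst p) \<partial>\<pi>)"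
    using integral_distr[OF f, of h] h d1 by (simp add: borel_measurable_integrable)
  also have "\<dots> \<le> (\<integral>p. g (snd p) + lam * dist (fst p) (snd p) \<partial>\<pi>)"
    using hi gi di le sp by (intro integral_mono) auto
  also have "\<dots> = (\<integral>p. g (snd p) \<partial>\<pi>) + lam * (\<integral>p. dist (fst p) (snd p) \<partial>\<pi>)"
    using gi di by simp
  also have "(\<integral>p. g (snd p) \<partial>\<pi>) = integral\<^sup>L Q g"
    using integral_distr[OF s, of g] g d2 by (simp add: borel_measurable_integrable)
  finally show ?thesis
    using mult_left_mono[OF dc lam] by linarith
qed

lemma integral_le_kantorovich:
  fixes P Q :: "'a::{metric_space, second_countable_topology} measure"
  assumes "(\<lambda>x. x) \<in> measurable P borel" "(\<lambda>x. x) \<in> measurable Q borel"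
    and "integrable P h" and "integrable Q g"
    and "\<And>x y. x \<in> space P \<Longrightarrow> y \<in> space Q \<Longrightarrow> h x \<le> g y + lam * dist x y"
    and "0 \<le> lam" and kant: "kantorovich P Q \<le> ennreal \<epsilon>" and "0 \<le> \<epsilon>"
  shows "integral\<^sup>L P h \<le> integral\<^sup>L Q g + lam * \<epsilon>"
proof -
  \<comment> \<open>The positive excess \<open>\<delta>\<close> yields a coupling of cost below
    \<open>\<epsilon> + \<delta>\<close> without attainment of the infimum.\<close>
  have step: "integral\<^sup>L P h \<le> integral\<^sup>L Q g + lam * (\<epsilon> + \<delta>)" if "\<delta> > 0" for \<delta>
  proof -
    have "kantorovich P Q < ennreal (\<epsilon> + \<delta>)"
      using kant that \<open>0 \<le> \<epsilon>\<close> by (intro le_less_trans[OF kant]) (simp add: ennreal_lessI)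
    then obtain \<pi> where \<pi>: "\<pi> \<in> couplings P Q"
      and "(\<integral>\<^sup>+(x, y). ennreal (dist x y) \<partial>\<pi>) < ennreal (\<epsilon> + \<delta>)"
      by (auto simp: kantorovich_def INF_less_iff)
    with assms that show ?thesis
      by (intro integral_le_coupling[OF \<pi>]) auto
  qed
  show ?thesis
  proof (rule tendsto_lowerbound)
    show "((\<lambda>\<delta>. integral\<^sup>L Q g + lam * (\<epsilon> + \<delta>)) \<longlongrightarrow> integral\<^sup>L Q g + lam * \<epsilon>) (at_right 0)"
      by (auto intro!: tendsto_eq_intros)
    show "\<forall>\<^sub>F \<delta> in at_right 0. integral\<^sup>L P h \<le> integral\<^sup>L Q g + lam * (\<epsilon> + \<delta>)"
      using step by (auto simp: eventually_at_right_less intro: eventually_mono[OF eventually_at_right_less])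
  qed simp
qed


section \<open>Piecewise linear interpolation of concave functions\<close>

text \<open>For \<open>x \<ge> a\<close> this is the linear interpolation of \<open>u\<close> at \<open>a, a + h, \<dots>, a + n * h\<close>, continued
  by a constant. The difference of ramps is the length of the part of the \<open>j\<close>-th cell above \<open>x\<close>.\<close>

definition ramp_interp :: "(real \<Rightarrow> real) \<Rightarrow> real \<Rightarrow> real \<Rightarrow> nat \<Rightarrow> real \<Rightarrow> real" where
  "ramp_interp u a h n x = u (a + real n * h) - (\<Sum>j<n. (u (a + real (Suc j) * h) - u (a + real j * h)) / h *
     (max 0 (a + real (Suc j) * h - x) - max 0 (a + real j * h - x)))"

text \<open>Each difference of ramps is non-increasing in \<open>x\<close>, has a nonnegative slope
  as weight and is subtracted.\<close>

lemma mono_ramp_interp: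
  assumes "mono u" "h > 0"
  shows "mono (ramp_interp u a h n)"
proof (rule monoI)
  fix x y :: real assume "x \<le> y"
  have "u (a + real j * h) \<le> u (a + real (Suc j) * h)" for j
    using assms by (intro monoD[OF assms(1)]) (simp add: algebra_simps)
  moreover have "a + real j * h \<le> a + real (Suc j) * h" for j
    using assms by (simp add: algebra_simps)
  ultimately show "ramp_interp u a h n x \<le> ramp_interp u a h n y"
    unfolding ramp_interp_def using \<open>x \<le> y\<close> \<open>h > 0\<close>
    by (intro diff_left_mono sum_mono mult_left_mono) (auto simp: max_def intro: order_trans)
qed

text \<open>At a grid point the cells below contribute nothing and those above contribute their full
  length \<open>h\<close>, which cancels the division; the remaining sum telescopes.\<close>

lemma ramp_interp_grid:
  assumes "h > 0" "m \<le> n"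
  shows "ramp_interp u a h n (a + real m * h) = u (a + real m * h)"
proof -
  have diff: "max 0 (real j * h - real m * h) = (if j \<le> m then 0 else real (j - m) * h)" for j
    using assms by (auto simp: max_def of_nat_diff algebra_simps)
  have "(\<Sum>j<n. (u (a + real (Suc j) * h) - u (a + real j * h)) / h *
     (max 0 (real (Suc j) * h - real m * h) - max 0 (real j * h - real m * h)))
    = (\<Sum>j\<in>{m..<n}. u (a + real (Suc j) * h) - u (a + real j * h))"
  proof (intro sum.mono_neutral_cong_right ballI)
    fix j assume "j \<in> {m..<n}"
    then have "max 0 (real (Suc j) * h - real m * h) - max 0 (real j * h - real m * h) = h"
      unfolding diff by (auto simp: Suc_diff_le algebra_simps)
    then show "(u (a + real (Suc j) * h) - u (a + real j * h)) / h *
       (max 0 (real (Suc j) * h - real m * h) - max 0 (real j * h - real m * h))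
      = u (a + real (Suc j) * h) - u (a + real j * h)"
      using assms(1) by simp
  next
    fix j assume "j \<in> {..<n} - {m..<n}"
    then show "(u (a + real (Suc j) * h) - u (a + real j * h)) / h *
       (max 0 (real (Suc j) * h - real m * h) - max 0 (real j * h - real m * h)) = 0"
      unfolding diff by auto
  qed auto
  also have "\<dots> = u (a + real n * h) - u (a + real m * h)"
    using assms(2) by (rule sum_Suc_diff')
  finally show ?thesis
    by (simp add: ramp_interp_def)
qed

lemma ramp_interp_const:
  assumes "h > 0" "a + real n * h \<le> x"
  shows "ramp_interp u a h n x = u (a + real n * h)"
proof -
  have "max 0 (a + real (Suc j) * h - x) = 0 \<and> max 0 (a + real j * h - x) = 0" if "j < n" for j
  proof -
    have "real (Suc j) * h \<le> real n * h" "real j * h \<le> real n * h"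
      using that assms by (intro mult_right_mono; simp)+
    then show ?thesis using assms by (intro conjI max_absorb1) linarith+
  qed
  then show ?thesis by (simp add: ramp_interp_def)
qed

text \<open>The points \<open>y\<close> and \<open>x + h\<close> are convex combinations of
  \<open>x\<close> and \<open>y + h\<close> with swapped weights; adding the two concavity
  inequalities gives the claim.\<close>

lemma concave_increment_antimono:
  fixes u :: "real \<Rightarrow> real"
  assumes "concave_on UNIV u" "x \<le> y" "0 < h"
  shows "u (y + h) - u y \<le> u (x + h) - u x"
proof -
  define D where "D = y + h - x"
  define t where "t = (y - x) / D"
  have D: "D > 0" and yh: "y + h = x + D" using assms by (auto simp: D_def)
  have t: "0 \<le> t" "t \<le> 1" using assms D by (auto simp: t_def D_def)
  have tD: "t * D = y - x" using D by (simp add: t_def)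
  have y: "(1 - t) *\<^sub>R x + t *\<^sub>R (x + D) = y"
    using tD by (simp add: algebra_simps)
  have xh: "(1 - (1 - t)) *\<^sub>R x + (1 - t) *\<^sub>R (x + D) = x + h"
    using tD yh by (simp add: algebra_simps)
  have "(1 - t) * u x + t * u (x + D) \<le> u y"
    using concave_onD[OF assms(1) t UNIV_I UNIV_I, of x "x + D"] unfolding y .
  moreover have "(1 - (1 - t)) * u x + (1 - t) * u (x + D) \<le> u (x + h)"
    using concave_onD[OF assms(1) _ _ UNIV_I UNIV_I, of "1 - t" x "x + D"] t unfolding xh by simp
  ultimately show ?thesis unfolding yh by (simp add: algebra_simps)
qed

text \<open>The chord through \<open>a - 1\<close> and \<open>a\<close>, extended to the right,
  stays above \<open>u\<close>. It supplies both linear growth for integrability and a bound on the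
  interpolation error.\<close>

lemma concave_le_chord:
  fixes u :: "real \<Rightarrow> real"
  assumes "concave_on UNIV u" "a \<le> x"
  shows "u x \<le> u a + (u a - u (a - 1)) * (x - a)"
proof (cases "x = a")
  case False
  then have x: "x > a" using assms by simp
  have "(- u (a - 1) - (- u a)) / (a - 1 - a) \<le> (- u a - (- u x)) / (a - x)"
    using convex_on_slope_le[of UNIV "\<lambda>x. - u x" "a - 1" x a] assms x
    by (auto simp: concave_on_def intro: order_trans)
  then have "(u x - u a) / (x - a) \<le> u a - u (a - 1)"
    using x by (simp add: field_simps)
  then show ?thesis using x by (simp add: pos_divide_le_eq)
qed simp

text \<open>Both functions are monotone and agree at the ends of the cell containing
  \<open>x\<close>, so they differ by at most the increment over that cell; by concavity the first
  cell has the largest one. Past the grid the interpolant stays constant, so only the first bound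
  survives.\<close>

lemma ramp_interp_bounds:
  assumes u: "mono u" "concave_on UNIV u" and h: "h > 0" and x: "a \<le> x"
  shows "ramp_interp u a h n x \<le> u x + (u (a + h) - u a)"
    and "x < a + real n * h \<Longrightarrow> u x \<le> ramp_interp u a h n x + (u (a + h) - u a)"
proof -
  have *: "ramp_interp u a h n x \<le> u x + (u (a + h) - u a) \<and> u x \<le> ramp_interp u a h n x + (u (a + h) - u a)"
    if xn: "x < a + real n * h"
  proof -
    define j where "j = nat \<lfloor>(x - a) / h\<rfloor>"
    have "real j \<le> (x - a) / h" "(x - a) / h < real (Suc j)"
      using x h by (simp_all add: j_def) linarith
    then have j: "a + real j * h \<le> x" "x \<le> a + real (Suc j) * h"
      using h by (auto simp: field_simps)
    then have "real j * h < real n * h" using xn by linarith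
    then have jn: "j < n" using h by simp
    have inc: "u (a + real (Suc j) * h) - u (a + real j * h) \<le> u (a + h) - u a"
      using concave_increment_antimono[OF u(2) _ h, of a "a + real j * h"] h by (simp add: algebra_simps)
    have "ramp_interp u a h n (a + real j * h) \<le> ramp_interp u a h n x"
      "ramp_interp u a h n x \<le> ramp_interp u a h n (a + real (Suc j) * h)"
      using j by (auto intro!: monoD[OF mono_ramp_interp[OF u(1) h]])
    moreover have "ramp_interp u a h n (a + real j * h) = u (a + real j * h)"
      "ramp_interp u a h n (a + real (Suc j) * h) = u (a + real (Suc j) * h)"
      using jn h by (auto intro!: ramp_interp_grid simp del: of_nat_Suc)
    moreover have "u (a + real j * h) \<le> u x" "u x \<le> u (a + real (Suc j) * h)"
      using j by (auto intro!: monoD[OF u(1)])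
    ultimately show ?thesis using inc by linarith
  qed
  show "x < a + real n * h \<Longrightarrow> u x \<le> ramp_interp u a h n x + (u (a + h) - u a)"
    using * by simp
  show "ramp_interp u a h n x \<le> u x + (u (a + h) - u a)"
  proof (cases "x < a + real n * h")
    case False
    then have "ramp_interp u a h n x = u (a + real n * h)"
      by (intro ramp_interp_const h) simp
    also have "\<dots> \<le> u x" using False by (intro monoD[OF u(1)]) simp
    also have "u a \<le> u (a + h)" using h by (intro monoD[OF u(1)]) simp
    ultimately show ?thesis by linarith
  qed (use * in simp)
qed

text \<open>Summation by parts.\<close>

lemma sum_antimono_increments_le:
  fixes c G :: "nat \<Rightarrow> real"
  assumes "\<And>j. c (Suc j) \<le> c j" "\<And>j. 0 \<le> c j" "\<And>j. G j \<le> 0" "G 0 = 0"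
  shows "(\<Sum>j<n. c j * (G (Suc j) - G j)) \<le> 0"
proof -
  \<comment> \<open>Keeping the boundary term \<open>c n * G n\<close> makes the induction go
    through: as \<open>G\<close> is nonpositive, passing to the smaller \<open>c (Suc n)\<close>
    only increases the bound.\<close>
  have "(\<Sum>j<n. c j * (G (Suc j) - G j)) \<le> c n * G n"
  proof (induction n)
    case (Suc n)
    have "(\<Sum>j<Suc n. c j * (G (Suc j) - G j)) \<le> c n * G (Suc n)"
      using Suc by (simp add: algebra_simps)
    also have "\<dots> \<le> c (Suc n) * G (Suc n)"
      using assms by (intro mult_right_mono_neg)
    finally show ?case .
  qed (simp add: assms)
  also have "\<dots> \<le> 0" using assms by (simp add: mult_nonneg_nonpos)
  finally show ?thesis .
qed

section \<open>Second-order dominance from expected ramps\<close>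

text \<open>The ramp test extends from \<open>[a, b]\<close> to all \<open>\<eta> \<ge> a\<close>
  and confines \<open>X\<close> to \<open>[a, \<infinity>)\<close>. There every utility is
  integrable and is approximated by interpolants, whose expectations are combinations of expected
  ramps.\<close>

lemma (in prob_space) ssd_dominatesI:
  assumes X: "integrable M X" and Y: "integrable M Y"
    and Yab: "AE \<omega> in M. a \<le> Y \<omega> \<and> Y \<omega> \<le> b" and "a \<le> b"
    and le: "\<And>\<eta>. a \<le> \<eta> \<Longrightarrow> \<eta> \<le> b \<Longrightarrow>
      expectation (\<lambda>\<omega>. max 0 (\<eta> - X \<omega>) - max 0 (\<eta> - Y \<omega>)) \<le> 0"
  shows "ssd_dominates M X Y"
  unfolding ssd_dominates_def
proof (intro allI impI)
  fix u :: "real \<Rightarrow> real" assume "mono u \<and> concave_on UNIV u"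
  then have u: "mono u" "concave_on UNIV u" by auto
  define F where "F \<eta> = expectation (\<lambda>\<omega>. max 0 (\<eta> - X \<omega>)) - expectation (\<lambda>\<omega>. max 0 (\<eta> - Y \<omega>))" for \<eta>
  have ri[simp]: "integrable M (\<lambda>\<omega>. max 0 (\<eta> - X \<omega>))" "integrable M (\<lambda>\<omega>. max 0 (\<eta> - Y \<omega>))" for \<eta>
    using X Y by auto
  have F_ab: "F \<eta> \<le> 0" if "a \<le> \<eta>" "\<eta> \<le> b" for \<eta>
    using le[OF that] by (simp add: F_def)
  \<comment> \<open>Beyond \<open>b\<close> the expected ramp of \<open>Y\<close> grows with slope
    exactly 1, that of \<open>X\<close> with slope at most 1.\<close>
  have F_ge: "F \<eta> \<le> 0" if "a \<le> \<eta>" for \<eta>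
  proof (cases "\<eta> \<le> b")
    case False
    have "expectation (\<lambda>\<omega>. max 0 (\<eta> - X \<omega>)) \<le> expectation (\<lambda>\<omega>. max 0 (b - X \<omega>) + (\<eta> - b))"
      using False by (intro integral_mono) auto
    also have "\<dots> = expectation (\<lambda>\<omega>. max 0 (b - X \<omega>)) + (\<eta> - b)"
      by (simp add: prob_space)
    finally have 1: "expectation (\<lambda>\<omega>. max 0 (\<eta> - X \<omega>)) \<le> expectation (\<lambda>\<omega>. max 0 (b - X \<omega>)) + (\<eta> - b)" .
    have "expectation (\<lambda>\<omega>. max 0 (b - Y \<omega>)) + (\<eta> - b) = expectation (\<lambda>\<omega>. max 0 (b - Y \<omega>) + (\<eta> - b))"
      by (simp add: prob_space)
    also have "\<dots> = expectation (\<lambda>\<omega>. max 0 (\<eta> - Y \<omega>))"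
    proof (rule integral_cong_AE)
      show "AE \<omega> in M. max 0 (b - Y \<omega>) + (\<eta> - b) = max 0 (\<eta> - Y \<omega>)"
        using Yab by eventually_elim (use False in auto)
    qed (use Y in auto)
    finally show ?thesis using 1 F_ab[of b] \<open>a \<le> b\<close> by (simp add: F_def)
  qed (use F_ab that in auto)
  \<comment> \<open>At \<open>\<eta> = a\<close> the ramp of \<open>Y\<close> vanishes almost
    surely, which forces the same for \<open>X\<close>.\<close>
  have Ya: "expectation (\<lambda>\<omega>. max 0 (a - Y \<omega>)) = 0"
    using Yab by (intro integral_eq_zero_AE) (auto elim!: eventually_mono)
  moreover have "0 \<le> expectation (\<lambda>\<omega>. max 0 (a - X \<omega>))"
    by (intro Bochner_Integration.integral_nonneg) simp
  ultimately have Xa: "expectation (\<lambda>\<omega>. max 0 (a - X \<omega>)) = 0"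
    using F_ge[OF order_refl] unfolding F_def by linarith
  then have "AE \<omega> in M. max 0 (a - X \<omega>) = 0"
    by (subst (asm) integral_nonneg_eq_0_iff_AE) auto
  then have aX: "AE \<omega> in M. a \<le> X \<omega>"
    by eventually_elim simp
  have aY: "AE \<omega> in M. a \<le> Y \<omega>"
    using Yab by eventually_elim simp
  \<comment> \<open>On \<open>[a, \<infinity>)\<close> monotonicity bounds \<open>u\<close> below by
    \<open>u a\<close>, and the extended chord bounds it above.\<close>
  have uint: "integrable M (\<lambda>\<omega>. u (W \<omega>))" if W: "integrable M W" and aW: "AE \<omega> in M. a \<le> W \<omega>" for W
  proof (rule Bochner_Integration.integrable_bound)
    show "integrable M (\<lambda>\<omega>. \<bar>u a\<bar> + (u a - u (a - 1)) * (W \<omega> - a))" using W by simp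
    show "(\<lambda>\<omega>. u (W \<omega>)) \<in> borel_measurable M"
      using borel_measurable_mono[OF u(1)] W by measurable
    show "AE \<omega> in M. norm (u (W \<omega>)) \<le> norm (\<bar>u a\<bar> + (u a - u (a - 1)) * (W \<omega> - a))"
      using aW
    proof eventually_elim
      case (elim \<omega>)
      have "u a \<le> u (W \<omega>)" "u (a - 1) \<le> u a" using elim by (auto intro!: monoD[OF u(1)])
      moreover have "0 \<le> (u a - u (a - 1)) * (W \<omega> - a)" using calculation elim by simp
      ultimately show ?case using concave_le_chord[OF u(2) elim] by simp
    qed
  qed
  \<comment> \<open>The factor 2 counts one interpolation error for \<open>Y\<close> and one for
    \<open>X\<close>.\<close>
  have step: "expectation (\<lambda>\<omega>. u (Y \<omega>)) \<le> expectation (\<lambda>\<omega>. u (X \<omega>)) + 2 * ((u a - u (a - 1)) * h)"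
    if h: "h > 0" for h
  proof -
    \<comment> \<open>The grid must cover the range of \<open>Y\<close>, where \<open>u\<close> is
      bounded by the interpolant. \<open>X\<close> may exceed it, since there only the opposite
      bound is used.\<close>
    obtain n :: nat where "b - a < real n * h" using reals_Archimedean3[OF h] by blast
    then have n: "b < a + real n * h" by simp
    define e where "e = u (a + h) - u a"
    define p where "p = ramp_interp u a h n"
    define c where "c j = (u (a + real (Suc j) * h) - u (a + real j * h)) / h" for j
    have pint[simp]: "integrable M (\<lambda>\<omega>. p (X \<omega>))" "integrable M (\<lambda>\<omega>. p (Y \<omega>))"
      by (auto simp: p_def ramp_interp_def intro!: Bochner_Integration.integrable_diff
          Bochner_Integration.integrable_sum integrable_mult_right simp del: of_nat_Suc)
    \<comment> \<open>The constant terms of the two interpolants cancel, leaving increments of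
      \<open>F\<close> weighted by the slopes of \<open>u\<close>.\<close>
    have "expectation (\<lambda>\<omega>. p (Y \<omega>)) - expectation (\<lambda>\<omega>. p (X \<omega>)) =
        (\<Sum>j<n. c j * (F (a + real (Suc j) * h) - F (a + real j * h)))"
      by (simp add: p_def ramp_interp_def F_def c_def[symmetric] prob_space sum_subtractf
          right_diff_distrib Bochner_Integration.integral_sum Bochner_Integration.integral_diff
          Bochner_Integration.integrable_sum Bochner_Integration.integrable_diff del: of_nat_Suc)
    also have "\<dots> \<le> 0"
    proof (rule sum_antimono_increments_le)
      show "c (Suc j) \<le> c j" for j
        using concave_increment_antimono[OF u(2) _ h, of "a + real j * h" "a + real (Suc j) * h"] h
        unfolding c_def by (intro divide_right_mono) (auto simp: algebra_simps)
      show "0 \<le> c j" for j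
        using h unfolding c_def by (auto intro!: divide_nonneg_pos monoD[OF u(1)] mult_right_mono)
      show "F (a + real j * h) \<le> 0" for j using h by (intro F_ge) simp
      \<comment> \<open>Both expected ramps vanish at \<open>a\<close>, so the summation by parts
        has no lower boundary term.\<close>
      show "F (a + real 0 * h) = 0" using Xa Ya by (simp add: F_def)
    qed
    finally have pp: "expectation (\<lambda>\<omega>. p (Y \<omega>)) \<le> expectation (\<lambda>\<omega>. p (X \<omega>))" by simp
    have "expectation (\<lambda>\<omega>. u (Y \<omega>)) \<le> expectation (\<lambda>\<omega>. p (Y \<omega>) + e)"
    proof (rule integral_mono_AE)
      show "AE \<omega> in M. u (Y \<omega>) \<le> p (Y \<omega>) + e"
        using Yab
      proof eventually_elim
        case (elim \<omega>)
        then show ?case using ramp_interp_bounds(2)[OF u h, of a "Y \<omega>" n] n by (simp add: p_def e_def)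
      qed
    qed (use uint[OF Y aY] in auto)
    moreover have "expectation (\<lambda>\<omega>. p (X \<omega>)) \<le> expectation (\<lambda>\<omega>. u (X \<omega>) + e)"
    proof (rule integral_mono_AE)
      show "AE \<omega> in M. p (X \<omega>) \<le> u (X \<omega>) + e"
        using aX
      proof eventually_elim
        case (elim \<omega>)
        then show ?case using ramp_interp_bounds(1)[OF u h, of a "X \<omega>" n] by (simp add: p_def e_def)
      qed
    qed (use uint[OF X aX] in auto)
    moreover have "e \<le> (u a - u (a - 1)) * h"
      using concave_le_chord[OF u(2), of a "a + h"] h by (simp add: e_def)
    ultimately show ?thesis
      using pp uint[OF X aX] by (simp add: prob_space)
  qed
  have "expectation (\<lambda>\<omega>. u (Y \<omega>)) \<le> expectation (\<lambda>\<omega>. u (X \<omega>))"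
  proof (rule tendsto_lowerbound)
    show "((\<lambda>h. expectation (\<lambda>\<omega>. u (X \<omega>)) + 2 * ((u a - u (a - 1)) * h)) \<longlongrightarrow>
        expectation (\<lambda>\<omega>. u (X \<omega>))) (at_right 0)"
      by (auto intro!: tendsto_eq_intros)
    show "\<forall>\<^sub>F h in at_right 0. expectation (\<lambda>\<omega>. u (Y \<omega>)) \<le>
        expectation (\<lambda>\<omega>. u (X \<omega>)) + 2 * ((u a - u (a - 1)) * h)"
      using step by (intro eventually_mono[OF eventually_at_right_less])
  qed simp
  then show "expectation_ereal M (\<lambda>\<omega>. u (Y \<omega>)) \<le> expectation_ereal M (\<lambda>\<omega>. u (X \<omega>))"
    using expectation_ereal_eq_integral[OF uint[OF X aX]]
      expectation_ereal_eq_integral[OF uint[OF Y aY]] by simp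
qed

section \<open>Measures in the ambiguity set\<close>

lemma prob_measuresD:
  assumes "P \<in> prob_measures \<Xi>"
  shows "prob_space P" "space P = \<Xi>" "(\<lambda>x. x) \<in> measurable P borel" "integrable P norm"
proof -
  show "prob_space P" "integrable P norm" using assms by (auto simp: prob_measures_def)
  have s: "sets P = sets (restrict_space borel \<Xi>)" using assms by (auto simp: prob_measures_def)
  show "space P = \<Xi>" using sets_eq_imp_space_eq[OF s] by (simp add: space_restrict_space)
  have "(\<lambda>x. x) \<in> measurable (restrict_space borel \<Xi>) borel"
    by (intro measurable_restrict_space1) simp
  then show "(\<lambda>x. x) \<in> measurable P borel"
    using measurable_cong_sets[OF s refl] by blast
qed

lemma integrable_inner_prob_measures:
  assumes "P \<in> prob_measures \<Xi>"
  shows "integrable P (\<lambda>\<xi>. z \<bullet> \<xi>)"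
proof (rule Bochner_Integration.integrable_bound)
  show "integrable P (\<lambda>\<xi>. norm z * norm \<xi>)" using prob_measuresD(4)[OF assms] by simp
  show "(\<lambda>\<xi>. z \<bullet> \<xi>) \<in> borel_measurable P"
    using prob_measuresD(3)[OF assms] by measurable
  show "AE \<xi> in P. norm (z \<bullet> \<xi>) \<le> norm (norm z * norm \<xi>)"
    using Cauchy_Schwarz_ineq2[of z] by auto
qed

text \<open>Since observations may coincide, the dual potential is not \<open>\<xi>h i \<mapsto> V i\<close> but the Lipschitz
  envelope \<open>y \<mapsto> min\<^sub>i (V i + lam * dist y (\<xi>h i))\<close>.\<close>

lemma integral_le_ambiguity_set:
  assumes P: "P \<in> ambiguity_set \<Xi> N \<xi>h \<epsilon>" and N: "N > 0" and \<xi>h: "\<forall>i\<in>{1..N}. \<xi>h i \<in> \<Xi>"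
    and "0 \<le> \<epsilon>" and lam: "0 \<le> lam" and h: "integrable P h"
    and le: "\<And>\<xi> i. \<xi> \<in> \<Xi> \<Longrightarrow> i \<in> {1..N} \<Longrightarrow> h \<xi> \<le> V i + lam * dist \<xi> (\<xi>h i)"
  shows "integral\<^sup>L P h \<le> lam * \<epsilon> + (1 / real N) * (\<Sum>i=1..N. V i)"
proof -
  define Q where "Q = empirical_measure \<Xi> N \<xi>h"
  define g where "g y = (MIN i\<in>{1..N}. V i + lam * dist y (\<xi>h i))" for y
  have Pm: "P \<in> prob_measures \<Xi>" and kant: "kantorovich P Q \<le> ennreal \<epsilon>"
    using P by (auto simp: ambiguity_set_def Q_def)
  have "\<xi>h \<in> measurable (count_space {1..N}) (restrict_space borel \<Xi>)"
    using \<xi>h by (auto simp: space_restrict_space)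
  then have \<xi>m: "\<xi>h \<in> measurable (uniform_count_measure {1..N}) (restrict_space borel \<Xi>)"
    using measurable_cong_sets[OF sets_uniform_count_measure_count_space refl] by blast
  have idm: "(\<lambda>x. x) \<in> measurable (restrict_space borel \<Xi>) borel"
    by (intro measurable_restrict_space1) simp
  have gm: "g \<in> borel_measurable (restrict_space borel \<Xi>)"
    unfolding g_def by (intro measurable_restrict_space1 borel_measurable_Min) auto
  have gi: "integrable Q g"
    unfolding Q_def empirical_measure_def integrable_distr_eq[OF \<xi>m gm]
    by (simp add: uniform_count_measure_def integrable_point_measure_finite)
  have "integral\<^sup>L P h \<le> integral\<^sup>L Q g + lam * \<epsilon>"
  proof (rule integral_le_kantorovich[OF prob_measuresD(3)[OF Pm] _ h gi _ lam kant \<open>0 \<le> \<epsilon>\<close>])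
    show "(\<lambda>x. x) \<in> measurable Q borel"
      using idm by (simp add: Q_def empirical_measure_def)
    fix x y assume "x \<in> space P"
    then have x: "x \<in> \<Xi>" using prob_measuresD(2)[OF Pm] by simp
    \<comment> \<open>An index attaining the minimum at \<open>y\<close> is also used for
      \<open>x\<close>; the triangle inequality pays for the move.\<close>
    have "g y \<in> (\<lambda>i. V i + lam * dist y (\<xi>h i)) ` {1..N}"
      unfolding g_def using N by (intro Min_in) auto
    then obtain i where i: "i \<in> {1..N}" "g y = V i + lam * dist y (\<xi>h i)" by auto
    have "h x \<le> V i + lam * dist x (\<xi>h i)" using le x i by simp
    also have "\<dots> \<le> V i + lam * (dist y (\<xi>h i) + dist x y)"
      using lam dist_triangle[of x "\<xi>h i" y] by (intro add_left_mono mult_left_mono) auto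
    finally show "h x \<le> g y + lam * dist x y" using i by (simp add: algebra_simps)
  qed
  also have "integral\<^sup>L Q g = (\<Sum>i=1..N. g (\<xi>h i)) / real N"
    unfolding Q_def empirical_measure_def integral_distr[OF \<xi>m gm]
    by (simp add: integral_uniform_count_measure)
  also have "\<dots> \<le> (\<Sum>i=1..N. V i) / real N"
  proof (intro divide_right_mono sum_mono)
    \<comment> \<open>At an observation its own index is a candidate at distance zero.\<close>
    fix i assume "i \<in> {1..N}"
    then have "g (\<xi>h i) \<le> V i + lam * dist (\<xi>h i) (\<xi>h i)"
      unfolding g_def by (intro Min_le image_eqI[where x = i]) auto
    then show "g (\<xi>h i) \<le> V i" by simp
  qed simp
  finally show ?thesis by simp
qed

section \<open>Comparison of the two optimal values\<close>

theorem theorem3: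
  fixes f :: "real^'n \<Rightarrow> real"
    and Z :: "(real^'n) set"
    and z0 :: "real^'n"
    and C :: "real^'n^'l"
    and d :: "real^'l"
    and Rmin Rmax \<epsilon> :: real
    and N K :: nat
    and \<xi>h :: "nat \<Rightarrow> real^'n"
  assumes "continuous_on UNIV f"
    and "polyhedron Z" and "bounded Z" and "z0 \<in> Z"
    and "compact ((\<lambda>\<xi>. z0 \<bullet> \<xi>) ` support_set C d)"
    and "(\<lambda>\<xi>. z0 \<bullet> \<xi>) ` support_set C d = {Rmin..Rmax}"
    and "N > 0" and "\<forall>i\<in>{1..N}. \<xi>h i \<in> support_set C d"
    and "\<epsilon> > 0" and "K > 0"
    and "\<forall>i\<in>{1..N}. \<forall>k\<in>{1..K}. \<forall>z\<in>Z.
          ssd1_strictly_feasible C d z0 z (\<xi>h i) (eta_lower Rmin Rmax K k) (eta_upper Rmin Rmax K k)"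
    and "\<forall>i\<in>{1..N}. \<forall>k\<in>{1..K}. \<forall>z\<in>Z.
          ssd2_strictly_feasible C d z0 z (\<xi>h i) (eta_lower Rmin Rmax K k) (eta_upper Rmin Rmax K k)"
  shows "optimal_value f (ssd_feasible Z z0 (ambiguity_set (support_set C d) N \<xi>h \<epsilon>))
      \<le> optimal_value (\<lambda>(z, _). f z) (ssdU_feasible Z z0 C d Rmin Rmax N \<xi>h \<epsilon> K)"
proof -
  note Rng = \<open>(\<lambda>\<xi>. z0 \<bullet> \<xi>) ` support_set C d = {Rmin..Rmax}\<close>
  let ?Q = "ambiguity_set (support_set C d) N \<xi>h \<epsilon>"
  have "\<xi>h 1 \<in> support_set C d" using \<open>N > 0\<close> \<open>\<forall>i\<in>{1..N}. \<xi>h i \<in> support_set C d\<close> by simp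
  then have "z0 \<bullet> \<xi>h 1 \<in> {Rmin..Rmax}" using Rng by blast
  then have R: "Rmin \<le> Rmax" by simp
  have feas: "z \<in> ssd_feasible Z z0 ?Q"
    if U: "(z, lam, \<mu>, \<mu>', \<nu>, \<nu>', V) \<in> ssdU_feasible Z z0 C d Rmin Rmax N \<xi>h \<epsilon> K" for z lam \<mu> \<mu>' \<nu> \<nu>' V
  proof -
    have "ssd_dominates P (\<lambda>\<xi>. z \<bullet> \<xi>) (\<lambda>\<xi>. z0 \<bullet> \<xi>)" if P: "P \<in> ?Q" for P
    proof -
      have Pm: "P \<in> prob_measures (support_set C d)" using P by (simp add: ambiguity_set_def)
      interpret prob_space P by (rule prob_measuresD(1)[OF Pm])
      note int = integrable_inner_prob_measures[OF Pm]
      show ?thesis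
      proof (rule ssd_dominatesI[OF int int _ R])
        show "AE \<xi> in P. Rmin \<le> z0 \<bullet> \<xi> \<and> z0 \<bullet> \<xi> \<le> Rmax"
          using Rng prob_measuresD(2)[OF Pm] by (intro AE_I2) (metis atLeastAtMost_iff imageI)
      next
        fix \<eta> assume "Rmin \<le> \<eta>" "\<eta> \<le> Rmax"
        \<comment> \<open>The cell, and with it \<open>lam k\<close> and the values
          \<open>V i k\<close>, depends on \<open>\<eta>\<close> but not on \<open>\<xi>\<close>, so
          one integral estimate suffices for each \<open>\<eta>\<close>.\<close>
        then obtain k where k: "k \<in> {1..K}" "eta_lower Rmin Rmax K k \<le> \<eta>" "\<eta> \<le> eta_upper Rmin Rmax K k"
          using eta_cover \<open>K > 0\<close> by blast
        have "expectation (\<lambda>\<xi>. max 0 (\<eta> - z \<bullet> \<xi>) - max 0 (\<eta> - z0 \<bullet> \<xi>))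
            \<le> lam k * \<epsilon> + (1 / real N) * (\<Sum>i=1..N. V i k)"
        proof (rule integral_le_ambiguity_set[OF P])
          show "integrable P (\<lambda>\<xi>. max 0 (\<eta> - z \<bullet> \<xi>) - max 0 (\<eta> - z0 \<bullet> \<xi>))"
            using int by auto
          fix \<xi> i assume "\<xi> \<in> support_set C d" "i \<in> {1..N}"
          moreover have "ssdU_constraints C d z0 z (\<xi>h i) (eta_lower Rmin Rmax K k) (eta_upper Rmin Rmax K k)
              (lam k) (\<mu> i k) (\<mu>' i k) (\<nu> i k) (\<nu>' i k) (V i k)"
            using U k(1) \<open>i \<in> {1..N}\<close> by (simp add: ssdU_feasible_def)
          ultimately show "max 0 (\<eta> - z \<bullet> \<xi>) - max 0 (\<eta> - z0 \<bullet> \<xi>) \<le> V i k + lam k * dist \<xi> (\<xi>h i)"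
            using k(2,3) by (intro ssdU_pointwise_bound)
        qed (use assms U k in \<open>auto simp: ssdU_feasible_def\<close>)
        also have "\<dots> \<le> 0" using U k by (auto simp: ssdU_feasible_def)
        finally show "expectation (\<lambda>\<xi>. max 0 (\<eta> - z \<bullet> \<xi>) - max 0 (\<eta> - z0 \<bullet> \<xi>)) \<le> 0" .
      qed
    qed
    then show ?thesis using U by (auto simp: ssd_feasible_def ssdU_feasible_def)
  qed
  show ?thesis
    unfolding optimal_value_def
  \<comment> \<open>Each feasible tuple offers its own \<open>z\<close> as a competitor of equal
    objective value; with no feasible tuple the right-hand side is infinite.\<close>
  proof (rule INF_greatest)
    fix v assume "v \<in> ssdU_feasible Z z0 C d Rmin Rmax N \<xi>h \<epsilon> K"
    then show "(INF z\<in>ssd_feasible Z z0 ?Q. ereal (f z)) \<le> ereal (case v of (z, _) \<Rightarrow> f z)"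
      using feas by (cases v) (auto intro: INF_lower)
  qed
qed

end
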